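(* Let $X$ and $Y$ be Banach spaces. Then the norm on $X\oplus_1 Y$ is octahedral if and only if the norm on $X$ is octahedral or the norm on $Y$ is octahedral.
   Context: All Banach spaces are real. $X\oplus_1Y$ is $X\times Y$ with norm $\|(x,y)\|=\|x\|+\|y\|$. The norm of a Banach space $Z$ (with unit sphere $S_Z$) is octahedral if for every finite-dimensional subspace $F\subseteq Z$ and every $\varepsilon>0$ there exists $z\in S_Z$ such that $\|y+\lambda z\|\geq(1-\varepsilon)(\|y\|+|\lambda|)$ for every $y\in F$ and every $\lambda\in\mathbb R$. *)

theory Defs
  imports "HOL-Analysis.Analysis"
begin

text \<open>The library's norm on \<^typ>\<open>'a \<times> 'b\<close> is the Euclidean combination of the two norms, so it is
  not the norm of the 1-sum. Octahedrality is therefore a predicate on a norm \<open>N\<close> given as a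
  function on a real vector space, and the 1-sum is the product vector space carrying \<open>l1_norm\<close>.\<close>

definition octahedral :: "('z::real_vector \<Rightarrow> real) \<Rightarrow> bool" where
  "octahedral N \<longleftrightarrow>
     (\<forall>F \<epsilon>. subspace F \<and> (\<exists>B. finite B \<and> F = span B) \<and> \<epsilon> > 0 \<longrightarrow>
        (\<exists>z. N z = 1 \<and>
           (\<forall>y\<in>F. \<forall>t::real. N (y + t *\<^sub>R z) \<ge> (1 - \<epsilon>) * (N y + \<bar>t\<bar>))))"

definition l1_norm :: "'a::real_normed_vector \<times> 'b::real_normed_vector \<Rightarrow> real" where
  "l1_norm p = norm (fst p) + norm (snd p)"

end

theory Submission
  imports Defs
begin

text \<open>Octahedrality of a summand passes to the sum through the vector \<open>(z, 0)\<close> or \<open>(0, z)\<close>.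
  Conversely, if neither summand is octahedral, then by homogeneity every vector \<open>z\<close> of each
  summand (not just unit vectors, and with \<open>t = 1\<close>) has a vector \<open>y\<close> of a fixed finite-dimensional
  subspace with \<open>\<parallel>y + z\<parallel> \<le> (1 - \<epsilon>) (\<parallel>y\<parallel> + \<parallel>z\<parallel>)\<close>. Adding the two inequalities for the components
  of a unit vector of the sum contradicts octahedrality there.\<close>

lemma octahedralD:
  assumes "octahedral N" "finite B" "\<epsilon> > 0"
  obtains z where "N z = 1" "\<And>y t. y \<in> span B \<Longrightarrow> (1 - \<epsilon>) * (N y + \<bar>t\<bar>) \<le> N (y + t *\<^sub>R z)"
  using assms unfolding octahedral_def by (metis subspace_span)

text \<open>A failing pair \<open>y\<close>, \<open>t\<close> for the unit vector in the direction
  of \<open>z\<close> can be rescaled so that the multiple of that vector becomes \<open>z\<close>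
  itself. The inequality is not strict because \<open>z = 0\<close> must be covered too: a component
  of a unit vector of the sum may vanish.\<close>

lemma not_octahedral_normE:
  assumes "\<not> octahedral (norm :: 'a::real_normed_vector \<Rightarrow> real)"
  obtains B :: "'a::real_normed_vector set" and \<epsilon> where "finite B" "\<epsilon> > 0"
    "\<And>z. \<exists>y\<in>span B. norm (y + z) \<le> (1 - \<epsilon>) * (norm y + norm z)"
proof -
  obtain B :: "'a set" and \<epsilon> where B: "finite B" "\<epsilon> > 0"
    and bad: "\<And>z. norm z = 1 \<Longrightarrow>
      \<exists>y\<in>span B. \<exists>t. norm (y + t *\<^sub>R z) < (1 - \<epsilon>) * (norm y + \<bar>t\<bar>)"
    using assms unfolding octahedral_def by (auto simp: not_le)
  have "\<exists>y\<in>span B. norm (y + z) \<le> (1 - \<epsilon>) * (norm y + norm z)" for z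
  proof (cases "z = 0")
    case True
    then show ?thesis by (intro bexI[of _ 0]) (auto simp: span_zero)
  next
    case False
    then have "norm (z /\<^sub>R norm z) = 1" by simp
    from bad[OF this] obtain y t where y: "y \<in> span B"
      and lt: "norm (y + t *\<^sub>R (z /\<^sub>R norm z)) < (1 - \<epsilon>) * (norm y + \<bar>t\<bar>)" by blast
    have "t \<noteq> 0"
    proof
      assume "t = 0"
      with lt have "norm y < norm y - \<epsilon> * norm y" by (simp add: algebra_simps)
      moreover have "0 \<le> \<epsilon> * norm y" using \<open>\<epsilon> > 0\<close> by simp
      ultimately show False by linarith
    qed
    \<comment> \<open>This factor carries \<open>t\<close> times the normalized \<open>z\<close> to
      \<open>z\<close>. It may be negative, so norms scale by \<open>\<bar>c\<bar>\<close>.\<close>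
    define c where "c = norm z / t"
    have c: "c \<noteq> 0" "\<bar>c\<bar> * \<bar>t\<bar> = norm z" and z: "c *\<^sub>R (t *\<^sub>R (z /\<^sub>R norm z)) = z"
      using \<open>t \<noteq> 0\<close> False by (auto simp: c_def abs_divide)
    have "norm (c *\<^sub>R y + z) = \<bar>c\<bar> * norm (y + t *\<^sub>R (z /\<^sub>R norm z))"
      by (metis z norm_scaleR scaleR_add_right)
    also have "\<dots> \<le> \<bar>c\<bar> * ((1 - \<epsilon>) * (norm y + \<bar>t\<bar>))"
      using lt by (intro mult_left_mono) auto
    also have "\<dots> = (1 - \<epsilon>) * (norm (c *\<^sub>R y) + norm z)"
      by (simp flip: c(2) add: algebra_simps)
    finally show ?thesis using span_scale[OF y] by blast
  qed
  with B that show ?thesis by blast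
qed

text \<open>The vector \<open>z\<close> is chosen for the projection of \<open>F\<close> to the
  first factor, which is spanned by the image of \<open>B\<close>. Adding a multiple of
  \<open>(z, 0)\<close> leaves the second component alone, and there the factor
  \<open>1 - \<epsilon>\<close> is at most 1.\<close>

lemma octahedral_l1_norm_fst:
  assumes "octahedral (norm :: 'a::real_normed_vector \<Rightarrow> real)"
  shows "octahedral (l1_norm :: 'a \<times> 'b::real_normed_vector \<Rightarrow> real)"
  unfolding octahedral_def
proof (intro allI impI, elim conjE exE)
  fix F B :: "('a \<times> 'b) set" and \<epsilon> :: real
  assume F: "finite B" "F = span B" and \<epsilon>: "\<epsilon> > 0"
  obtain z :: 'a where z: "norm z = 1"
    and le: "\<And>y t. y \<in> span (fst ` B) \<Longrightarrow> (1 - \<epsilon>) * (norm y + \<bar>t\<bar>) \<le> norm (y + t *\<^sub>R z)"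
    using octahedralD[OF assms, of "fst ` B" \<epsilon>] F \<epsilon> by auto
  have "(1 - \<epsilon>) * (l1_norm y + \<bar>t\<bar>) \<le> l1_norm (y + t *\<^sub>R (z, 0))" if "y \<in> F" for y t
  proof -
    have "fst y \<in> span (fst ` B)"
      using that F(2) linear_span_image[OF linear_fst, of B] by blast
    moreover have "(1 - \<epsilon>) * norm (snd y) \<le> norm (snd y)"
      using \<epsilon> by (simp add: algebra_simps)
    ultimately show ?thesis
      using le[of "fst y" t] by (simp add: l1_norm_def algebra_simps)
  qed
  with z show "\<exists>z. l1_norm z = 1 \<and>
      (\<forall>y\<in>F. \<forall>t. (1 - \<epsilon>) * (l1_norm y + \<bar>t\<bar>) \<le> l1_norm (y + t *\<^sub>R z))"
    by (intro exI[of _ "(z, 0)"]) (auto simp: l1_norm_def)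
qed

text \<open>Serves to exchange the two summands. A finite spanning set is pulled back along
  \<open>f\<close>, and the vector found there is pushed forward.\<close>

lemma octahedral_linear_isometry:
  fixes N :: "'a::real_vector \<Rightarrow> real" and M :: "'b::real_vector \<Rightarrow> real"
  assumes "octahedral N" "linear f" "surj f" "\<And>x. M (f x) = N x"
  shows "octahedral M"
  unfolding octahedral_def
proof (intro allI impI, elim conjE exE)
  fix F B :: "'b set" and \<epsilon> :: real
  assume F: "finite B" "F = span B" and \<epsilon>: "\<epsilon> > 0"
  obtain C where C: "finite C" "B = f ` C"
    using finite_subset_image[OF F(1), of f UNIV] \<open>surj f\<close> by auto
  have span: "F = f ` span C"
    using F(2) C(2) linear_span_image[OF \<open>linear f\<close>] by simp
  obtain z where z: "N z = 1"
    and le: "\<And>y t. y \<in> span C \<Longrightarrow> (1 - \<epsilon>) * (N y + \<bar>t\<bar>) \<le> N (y + t *\<^sub>R z)"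
    using octahedralD[OF assms(1) C(1) \<epsilon>] by blast
  have "(1 - \<epsilon>) * (M (f y) + \<bar>t\<bar>) \<le> M (f y + t *\<^sub>R f z)" if "y \<in> span C" for y t
    using le[OF that, of t] \<open>linear f\<close> by (simp flip: assms(4) add: linear_add linear_scale)
  with z show "\<exists>z. M z = 1 \<and> (\<forall>y\<in>F. \<forall>t. (1 - \<epsilon>) * (M y + \<bar>t\<bar>) \<le> M (y + t *\<^sub>R z))"
    by (intro exI[of _ "f z"]) (auto simp: span assms(4))
qed

lemma octahedral_l1_norm_snd:
  assumes "octahedral (norm :: 'b::real_normed_vector \<Rightarrow> real)"
  shows "octahedral (l1_norm :: 'a::real_normed_vector \<times> 'b \<Rightarrow> real)"
proof (rule octahedral_linear_isometry)
  show "octahedral (l1_norm :: 'b \<times> 'a \<Rightarrow> real)"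
    using assms by (rule octahedral_l1_norm_fst)
  show "linear (prod.swap :: 'b \<times> 'a \<Rightarrow> 'a \<times> 'b)"
    by (rule linearI) auto
qed (auto simp: l1_norm_def)

lemma octahedral_l1_normD:
  assumes "octahedral (l1_norm :: 'a::real_normed_vector \<times> 'b::real_normed_vector \<Rightarrow> real)"
  shows "octahedral (norm :: 'a \<Rightarrow> real) \<or> octahedral (norm :: 'b \<Rightarrow> real)"
proof (rule ccontr)
  assume neg: "\<not> ?thesis"
  obtain A :: "'a set" and \<alpha> where A: "finite A" "\<alpha> > 0"
    and bad_a: "\<And>z. \<exists>y\<in>span A. norm (y + z) \<le> (1 - \<alpha>) * (norm y + norm z)"
    using neg not_octahedral_normE by metis
  obtain B :: "'b set" and \<beta> where B: "finite B" "\<beta> > 0"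
    and bad_b: "\<And>z. \<exists>y\<in>span B. norm (y + z) \<le> (1 - \<beta>) * (norm y + norm z)"
    using neg not_octahedral_normE by metis
  \<comment> \<open>The span of \<open>C\<close> contains the product of the spans of
    \<open>A\<close> and \<open>B\<close>.\<close>
  define C where "C = (\<lambda>x. (x, 0)) ` A \<union> (\<lambda>y. (0, y)) ` B"
  have lin: "linear (\<lambda>x::'a. (x, 0::'b))" "linear (\<lambda>y::'b. (0::'a, y))"
    by (auto intro: linearI)
  \<comment> \<open>Halving leaves a gap: octahedrality bounds the sum below with factor
    \<open>1 - \<epsilon>\<close>, the two components bound it above with
    \<open>1 - 2 * \<epsilon>\<close>.\<close>
  define \<epsilon> where "\<epsilon> = min \<alpha> \<beta> / 2"
  have \<epsilon>: "\<epsilon> > 0" "2 * \<epsilon> \<le> \<alpha>" "2 * \<epsilon> \<le> \<beta>"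
    using A(2) B(2) by (auto simp: \<epsilon>_def)
  have "finite C" using A B by (simp add: C_def)
  then obtain z where z: "l1_norm z = 1"
    and le: "\<And>y t. y \<in> span C \<Longrightarrow> (1 - \<epsilon>) * (l1_norm y + \<bar>t\<bar>) \<le> l1_norm (y + t *\<^sub>R z)"
    using octahedralD[OF assms _ \<epsilon>(1)] by blast
  \<comment> \<open>Both components of \<open>z\<close> enter with the same coefficient 1, so
    \<open>a\<close> and \<open>b\<close> combine into one vector tested against
    \<open>z\<close>.\<close>
  obtain a where a: "a \<in> span A" "norm (a + fst z) \<le> (1 - \<alpha>) * (norm a + norm (fst z))"
    using bad_a by blast
  obtain b where b: "b \<in> span B" "norm (b + snd z) \<le> (1 - \<beta>) * (norm b + norm (snd z))"
    using bad_b by blast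
  have "(a, 0) \<in> span C" "(0, b) \<in> span C"
    using a(1) b(1) linear_span_image[OF lin(1), of A] linear_span_image[OF lin(2), of B]
      span_mono[of "(\<lambda>x. (x, 0)) ` A" C] span_mono[of "(\<lambda>y. (0, y)) ` B" C]
    by (auto simp: C_def)
  from span_add[OF this] have "(a, b) \<in> span C" by simp
  \<comment> \<open>The summand 1 is both \<open>\<bar>t\<bar>\<close> for \<open>t = 1\<close> and
    the norm of \<open>z\<close>; it also keeps \<open>s\<close> positive when \<open>a\<close> and
    \<open>b\<close> vanish.\<close>
  define s where "s = l1_norm (a, b) + 1"
  have "s > 0" by (simp add: s_def l1_norm_def add_nonneg_pos)
  have "(1 - \<epsilon>) * s \<le> l1_norm ((a, b) + z)"
    using le[OF \<open>(a, b) \<in> span C\<close>, of 1] by (simp add: s_def)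
  also have "\<dots> = norm (a + fst z) + norm (b + snd z)"
    by (simp add: l1_norm_def)
  also have "\<dots> \<le> (1 - 2 * \<epsilon>) * (norm a + norm (fst z)) + (1 - 2 * \<epsilon>) * (norm b + norm (snd z))"
    using a(2) b(2) \<epsilon> by (intro add_mono order_trans[OF a(2)] order_trans[OF b(2)] mult_right_mono) auto
  also have "\<dots> = (1 - 2 * \<epsilon>) * s"
    using z by (simp add: s_def l1_norm_def flip: distrib_left)
  finally have "\<epsilon> * s \<le> 0" by (simp add: algebra_simps)
  with \<open>\<epsilon> > 0\<close> \<open>s > 0\<close> show False by (simp add: mult_le_0_iff)
qed

theorem proposition3p7:
  shows "octahedral (l1_norm :: 'a::banach \<times> 'b::banach \<Rightarrow> real) \<longleftrightarrow>
    octahedral (norm :: 'a \<Rightarrow> real) \<or> octahedral (norm :: 'b \<Rightarrow> real)"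
  using octahedral_l1_normD octahedral_l1_norm_fst octahedral_l1_norm_snd by blast

end
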